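(* Let $X \sim p_X$ be a discrete random variable (the source). Let $n \ge 1$ and let $Z^n = (Z_1,\dots,Z_n)$ be a discrete random vector with i.i.d. components (the $n$-dimensional noise), with Shannon entropy $H(Z^n) = 26.55\,n$ bits. Let $g_\theta$ be a deterministic map, let $\hat X = g_\theta(Z^n)$, and let $q_{\hat X;\theta}$ be the distribution of $\hat X$. Let $d(\cdot,\cdot)$ be a divergence between probability distributions. If the perfect divergence $d(p_X, q_{\hat X;\theta}) = 0$ is achieved, then the noise dimension $n$ satisfies $$ n \ \ge\ \frac{H(X)}{26.55}\ \ge\ \frac{\mathbb{E}[\mathcal{L}(X)] - 1}{26.55}, $$ where $\mathbb{E}[\mathcal{L}(X)]$ is the minimal expected number of bits required to losslessly encode the source $X$. If moreover $g_\theta$ is bijective, then $$ n \ \le\ \frac{H(X) + 2}{26.55}\ \le\ \frac{\mathbb{E}[\mathcal{L}(X)] + 2}{26.55}. $$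
   Context: All entropies are Shannon entropies of discrete random variables in bits: $H(Y) = -\sum_y \Pr(Y=y)\log_2 \Pr(Y=y)$. A divergence $d(p,q)$ is a nonnegative function of two probability distributions on the same alphabet with $d(p,q)=0$ if and only if $p=q$ (e.g. Jensen–Shannon divergence, Wasserstein distance). Noise model: a generative adversarial network (GAN) is viewed as a discrete sampler, $\hat X = g_\theta(Z^n)$ with $g_\theta$ deterministic. The components of $Z^n$ are independent standard Gaussians represented in 32-bit floating point, i.e. each component takes the floating-point value $z_i$ with probability equal to the standard Gaussian measure of the interval from the midpoint of $z_{i-1},z_i$ to the midpoint of $z_i,z_{i+1}$, where $z_{i-1},z_{i+1}$ are the neighbouring floating-point numbers. The numerical value of the entropy of one such component is $26.55$ bits, and the convention is $H(Z^n) = 26.55\,n$; only this entropy value of the noise is relevant to the claim. "$g_\theta$ is bijective" means that $g_\theta$ is a bijection from the support of $Z^n$ onto the support of $\hat X$. $\mathbb{E}[\mathcal{L}(X)]$ denotes the minimum, over all binary prefix-free (lossless) codes for the alphabet of $X$, of the expected codeword length when the symbol is drawn from $p_X$. *)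

theory Defs
  imports "HOL-Probability.Probability" "HOL-Library.Sublist"
begin

text \<open>
  Discrete random variables enter only through their laws, which are probability mass functions.
  Entropies and expected lengths are sums of nonnegative terms taken in the extended reals, so that
  a divergent sum has the value \<open>\<infinity>\<close> rather than a default value.
\<close>

text \<open>Shannon entropy in bits. Symbols of probability \<open>0\<close> contribute \<open>0 * log 2 0 = 0\<close>.\<close>

definition shannon_entropy :: "'a pmf \<Rightarrow> ereal" where
  "shannon_entropy p = (\<Sum>\<^sub>\<infinity>y. ereal (- (pmf p y * log 2 (pmf p y))))"

text \<open>For finite entropy this is the entropy of the library, which is real-valued.\<close>

lemma shannon_entropy_eq_entropy:
  fixes p :: "'a :: countable pmf"
  assumes "integrable (count_space UNIV) (\<lambda>y. pmf p y * log 2 (pmf p y))"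
  shows "shannon_entropy p = ereal (prob_space.entropy (measure_pmf p) 2 (count_space UNIV) (\<lambda>y. y))"
proof -
  have I: "information_space (measure_pmf p) 2"
    by (intro information_space.intro measure_pmf.prob_space_axioms) (simp add: information_space_axioms_def)
  define f where "f y = - (pmf p y * log 2 (pmf p y))" for y
  have abs: "Infinite_Set_Sum.abs_summable_on f UNIV"
    using assms by (simp add: Infinite_Set_Sum.abs_summable_on_def f_def)
  have "distributed (measure_pmf p) (count_space UNIV) (\<lambda>y. y) (\<lambda>y. pmf p y)"
    by (simp add: distributed_def distr_id2 measure_pmf_eq_density[symmetric])
  then have "prob_space.entropy (measure_pmf p) 2 (count_space UNIV) (\<lambda>y. y)
      = - (\<integral>y. pmf p y * log 2 (pmf p y) \<partial>count_space UNIV)"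
    by (subst information_space.entropy_distr[OF I]) auto
  also have "\<dots> = infsetsum f UNIV"
    by (simp add: infsetsum_def f_def)
  also have "\<dots> = infsum f UNIV"
    by (rule infsetsum_infsum[OF abs])
  finally have e: "prob_space.entropy (measure_pmf p) 2 (count_space UNIV) (\<lambda>y. y) = infsum f UNIV" .
  have s: "f summable_on UNIV"
    using abs abs_summable_equivalent abs_summable_summable by blast
  have "infsum (ereal \<circ> f) UNIV = ereal (infsum f UNIV)"
    by (rule infsum_comm_additive_general) (use s in \<open>auto\<close>)
  then show ?thesis
    unfolding e shannon_entropy_def by (simp add: o_def f_def)
qed

definition divergence_on :: "'a set \<Rightarrow> ('a pmf \<Rightarrow> 'a pmf \<Rightarrow> ereal) \<Rightarrow> bool" where
  "divergence_on A d \<longleftrightarrow>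
     (\<forall>p q. set_pmf p \<subseteq> A \<longrightarrow> set_pmf q \<subseteq> A \<longrightarrow> 0 \<le> d p q \<and> (d p q = 0 \<longleftrightarrow> p = q))"

text \<open>
  Being prefix-free includes injectivity. The empty codeword is allowed, but only a one-letter
  alphabet can make use of it.
\<close>

definition prefix_free_code :: "'a set \<Rightarrow> ('a \<Rightarrow> bool list) \<Rightarrow> bool" where
  "prefix_free_code A c \<longleftrightarrow> (\<forall>x\<in>A. \<forall>y\<in>A. prefix (c x) (c y) \<longrightarrow> x = y)"

definition expected_length :: "'a pmf \<Rightarrow> ('a \<Rightarrow> bool list) \<Rightarrow> ereal" where
  "expected_length p c = (\<Sum>\<^sub>\<infinity>x. ereal (pmf p x * real (length (c x))))"

text \<open>
  The infimum is the minimum whenever the latter exists, in particular when \<open>A\<close> is finite, or when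
  \<open>A = set_pmf p\<close> and the entropy is finite.
\<close>

definition min_expected_length :: "'a set \<Rightarrow> 'a pmf \<Rightarrow> ereal" where
  "min_expected_length A p = (INF c\<in>{c. prefix_free_code A c}. expected_length p c)"

end

theory Submission
  imports Defs
begin

text \<open>
  Zero divergence means that the source and the output of the generator have the same law, so
  \<open>H(X) = H(g(Z)) \<le> H(Z) = 26.55 n\<close>, with equality if \<open>g\<close> is injective on the support of \<open>Z\<close>. The
  bounds in terms of the expected code length are Shannon's noiseless coding theorem
  \<open>H(X) \<le> E[L(X)] \<le> H(X) + 1\<close>. Since every entropy and expected length has nonnegative summands, they
  are handled as nonnegative Lebesgue integrals against the law, and no case distinction on
  finiteness is needed.
\<close>

section \<open>Infinite sums as nonnegative integrals\<close>

text \<open>Monotone convergence along the finite initial segments of an enumeration of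
  \<open>A\<close> passes a bound on all finite sums to the integral.\<close>

lemma nn_integral_count_space_le:
  fixes f :: "'a \<Rightarrow> ennreal"
  assumes "countable A"
    and le: "\<And>F. finite F \<Longrightarrow> F \<subseteq> A \<Longrightarrow> sum f F \<le> C"
  shows "(\<integral>\<^sup>+x. f x \<partial>count_space A) \<le> C"
proof (cases "A = {}")
  case False
  define F where "F n = from_nat_into A ` {..n}" for n :: nat
  have F: "finite (F n)" "F n \<subseteq> A" for n
    using from_nat_into[OF False] by (auto simp: F_def)
  have inc: "incseq (\<lambda>n x. f x * indicator (F n) x)"
    by (auto simp: incseq_def le_fun_def F_def split: split_indicator)
  have SUP: "(SUP n. f x * indicator (F n) x) = f x" if "x \<in> A" for x
  proof (rule antisym)
    show "(SUP n. f x * indicator (F n) x) \<le> f x"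
      by (intro SUP_least) (auto split: split_indicator)
    have "x \<in> F (to_nat_on A x)"
      using that assms(1) unfolding F_def by (intro image_eqI[of _ _ "to_nat_on A x"]) auto
    then show "f x \<le> (SUP n. f x * indicator (F n) x)"
      by (intro SUP_upper2[of "to_nat_on A x"]) auto
  qed
  have "(\<integral>\<^sup>+x. f x \<partial>count_space A) = (\<integral>\<^sup>+x. (SUP n. f x * indicator (F n) x) \<partial>count_space A)"
    by (intro nn_integral_cong) (simp add: SUP)
  also have "\<dots> = (SUP n. \<integral>\<^sup>+x. f x * indicator (F n) x \<partial>count_space A)"
    by (intro nn_integral_monotone_convergence_SUP inc) auto
  also have "\<dots> \<le> C"
  proof (rule SUP_least)
    fix n
    have "(\<integral>\<^sup>+x. f x * indicator (F n) x \<partial>count_space A) = (\<Sum>x\<in>F n. f x * indicator (F n) x)"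
      using F[of n] by (intro nn_integral_count_space') auto
    also have "\<dots> = sum f (F n)"
      by (intro sum.cong) auto
    finally show "(\<integral>\<^sup>+x. f x * indicator (F n) x \<partial>count_space A) \<le> C"
      using le[OF F] by simp
  qed
  finally show ?thesis .
qed (simp add: nn_integral_empty)

text \<open>Restricting to the support, which is countable even if the type is not, gives access to
  \<open>nn_integral_count_space_le\<close>.\<close>

lemma nn_integral_measure_pmf_set:
  "(\<integral>\<^sup>+x. f x \<partial>measure_pmf p) = (\<integral>\<^sup>+x. ennreal (pmf p x) * f x \<partial>count_space (set_pmf p))"
  unfolding nn_integral_measure_pmf
  by (intro nn_integral_count_space_eq) (auto simp: set_pmf_iff)

text \<open>Both sides are the supremum of the finite partial sums. This is the bridge from the
  definitions, stated with infinite sums, to integrals against the law.\<close>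

lemma infsum_pmf_eq_nn_integral:
  fixes p :: "'a pmf" and f :: "'a \<Rightarrow> real"
  assumes "\<And>x. 0 \<le> f x"
  shows "(\<Sum>\<^sub>\<infinity>x. ereal (pmf p x * f x)) = enn2ereal (\<integral>\<^sup>+x. ennreal (f x) \<partial>measure_pmf p)"
proof -
  define I where "I = (\<integral>\<^sup>+x. ennreal (f x) \<partial>measure_pmf p)"
  define S where "S = (SUP F\<in>{F. finite F \<and> F \<subseteq> UNIV}. \<Sum>x\<in>F. ereal (pmf p x * f x))"
  have infsum_eq: "(\<Sum>\<^sub>\<infinity>x. ereal (pmf p x * f x)) = S"
    unfolding S_def by (intro nonneg_infsum_complete) (auto simp: assms)
  have ennreal_sum: "(\<Sum>x\<in>F. ennreal (pmf p x) * ennreal (f x)) = ennreal (\<Sum>x\<in>F. pmf p x * f x)" for F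
    by (subst sum_ennreal[symmetric]) (auto simp: assms ennreal_mult)
  have ge0: "0 \<le> S"
    unfolding S_def by (intro SUP_upper2[of "{}"]) auto
  have "S \<le> enn2ereal I"
    unfolding S_def
  proof (rule SUP_least)
    fix F :: "'a set" assume "F \<in> {F. finite F \<and> F \<subseteq> UNIV}"
    then have F: "finite F" by simp
    have "ennreal (\<Sum>x\<in>F. pmf p x * f x)
        = (\<integral>\<^sup>+x. ennreal (pmf p x) * ennreal (f x) * indicator F x \<partial>count_space UNIV)"
      using F by (subst nn_integral_count_space'[of F]) (auto simp: ennreal_sum[symmetric])
    also have "\<dots> \<le> I"
      unfolding I_def nn_integral_measure_pmf
      by (intro nn_integral_mono) (auto split: split_indicator)
    finally have "enn2ereal (ennreal (\<Sum>x\<in>F. pmf p x * f x)) \<le> enn2ereal I"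
      by (simp add: less_eq_ennreal.rep_eq)
    then show "(\<Sum>x\<in>F. ereal (pmf p x * f x)) \<le> enn2ereal I"
      by (simp add: enn2ereal_ennreal sum_nonneg assms)
  qed
  moreover have "I \<le> e2ennreal S"
    unfolding I_def nn_integral_measure_pmf_set
  proof (rule nn_integral_count_space_le)
    fix F :: "'a set" assume "finite F"
    then have "(\<Sum>x\<in>F. ereal (pmf p x * f x)) \<le> S"
      unfolding S_def by (intro SUP_upper) auto
    then show "(\<Sum>x\<in>F. ennreal (pmf p x) * ennreal (f x)) \<le> e2ennreal S"
      unfolding ennreal_sum using e2ennreal_mono by fastforce
  qed simp
  then have "enn2ereal I \<le> S"
    using ge0 by (metis enn2ereal_e2ennreal less_eq_ennreal.rep_eq)
  ultimately show ?thesis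
    using infsum_eq I_def by simp
qed

text \<open>At probability 0 the logarithm takes the default value 0, so the bound holds at every
  \<open>x\<close>, as \<open>infsum_pmf_eq_nn_integral\<close> requires.\<close>

lemma neg_log_pmf_nonneg: "0 \<le> - log 2 (pmf p x)"
proof (cases "pmf p x = 0")
  case False
  then have "log 2 (pmf p x) \<le> 0"
    using pmf_le_1[of p x] pmf_nonneg[of p x] by (subst log_le_zero_cancel_iff) auto
  then show ?thesis by simp
qed (simp add: log_def)

lemma shannon_entropy_eq_nn_integral:
  "shannon_entropy p = enn2ereal (\<integral>\<^sup>+x. ennreal (- log 2 (pmf p x)) \<partial>measure_pmf p)"
  unfolding shannon_entropy_def
  by (subst infsum_pmf_eq_nn_integral[symmetric]) (use neg_log_pmf_nonneg in auto)

lemma expected_length_eq_nn_integral: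
  "expected_length p c = enn2ereal (\<integral>\<^sup>+x. ennreal (real (length (c x))) \<partial>measure_pmf p)"
  unfolding expected_length_def by (rule infsum_pmf_eq_nn_integral) simp

section \<open>Entropy under a deterministic map\<close>

lemma pmf_le_pmf_map: "pmf p x \<le> pmf (map_pmf g p) (g x)"
proof -
  have "measure p {x} \<le> measure p (g -` {g x})"
    by (intro measure_pmf.finite_measure_mono) auto
  then show ?thesis by (simp add: pmf_map measure_pmf_single)
qed

text \<open>Merging letters never lowers a probability, so the integrand \<open>- log 2\<close> does
  not increase at any point once the entropy of the image is written as an integral against
  \<open>p\<close>.\<close>

lemma shannon_entropy_map_le: "shannon_entropy (map_pmf g p) \<le> shannon_entropy p"
proof -
  have "(\<integral>\<^sup>+x. ennreal (- log 2 (pmf (map_pmf g p) (g x))) \<partial>measure_pmf p)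
      \<le> (\<integral>\<^sup>+x. ennreal (- log 2 (pmf p x)) \<partial>measure_pmf p)"
  proof (intro nn_integral_mono_AE, unfold AE_measure_pmf_iff, intro ballI ennreal_leI)
    fix x assume "x \<in> set_pmf p"
    then have "0 < pmf p x" by (rule pmf_positive)
    then have "log 2 (pmf p x) \<le> log 2 (pmf (map_pmf g p) (g x))"
      using pmf_le_pmf_map[of p x g] by (subst log_le_cancel_iff) linarith+
    then show "- log 2 (pmf (map_pmf g p) (g x)) \<le> - log 2 (pmf p x)" by simp
  qed
  then show ?thesis
    unfolding shannon_entropy_eq_nn_integral by (simp add: less_eq_ennreal.rep_eq)
qed

lemma shannon_entropy_map_inj:
  assumes "inj_on g (set_pmf p)"
  shows "shannon_entropy (map_pmf g p) = shannon_entropy p"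
  unfolding shannon_entropy_eq_nn_integral nn_integral_map_pmf
  by (intro arg_cong[of _ _ enn2ereal] nn_integral_cong_AE)
    (auto simp: AE_measure_pmf_iff pmf_map_inj[OF assms])

section \<open>Kraft's inequality and the lower bound on the expected length\<close>

lemma card_lists_prefix:
  fixes u :: "bool list"
  assumes "length u \<le> N"
  shows "card {w. length w = N \<and> prefix u w} = 2 ^ (N - length u)"
proof -
  have "{w. length w = N \<and> prefix u w} = (@) u ` {v. length v = N - length u}"
    using assms by (auto simp: prefix_def)
  moreover have "card {v :: bool list. length v = N - length u} = 2 ^ (N - length u)"
    using card_lists_length_eq[of "UNIV :: bool set" "N - length u"] by simp
  ultimately show ?thesis
    by (simp add: card_image inj_on_def)
qed

text \<open>Let \<open>N\<close> bound the codeword lengths occurring in \<open>F\<close>. The words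
  of length \<open>N\<close> that extend different codewords form disjoint sets, since two prefixes
  of one word are comparable, and there are only \<open>2 ^ N\<close> words in all.\<close>

lemma kraft_inequality:
  assumes c: "prefix_free_code A c" and F: "finite F" "F \<subseteq> A"
  shows "(\<Sum>x\<in>F. (1/2 :: real) ^ length (c x)) \<le> 1"
proof -
  define N where "N = Max (insert 0 ((\<lambda>x. length (c x)) ` F))"
  have N: "length (c x) \<le> N" if "x \<in> F" for x
    using that F unfolding N_def by (intro Max_ge) auto
  define W where "W x = {w. length w = N \<and> prefix (c x) w}" for x
  have fin: "finite {w :: bool list. length w = N}"
    using finite_lists_length_eq[of "UNIV :: bool set" N] by simp
  have finW: "finite (W x)" for x
    by (rule finite_subset[OF _ fin]) (auto simp: W_def)
  have disj: "W x \<inter> W y = {}" if "x \<in> F" "y \<in> F" "x \<noteq> y" for x y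
  proof -
    have "\<not> prefix (c x) (c y)" "\<not> prefix (c y) (c x)"
      using c F that unfolding prefix_free_code_def by blast+
    then show ?thesis
      unfolding W_def using prefix_same_cases by blast
  qed
  have "(\<Sum>x\<in>F. 2 ^ (N - length (c x))) = (\<Sum>x\<in>F. card (W x))"
    unfolding W_def using N by (intro sum.cong) (auto simp: card_lists_prefix)
  also have "\<dots> = card (\<Union>x\<in>F. W x)"
    using F finW disj by (subst card_UN_disjoint) auto
  also have "\<dots> \<le> card {w :: bool list. length w = N}"
    by (intro card_mono fin) (auto simp: W_def)
  also have "\<dots> = 2 ^ N"
    using card_lists_length_eq[of "UNIV :: bool set" N] by simp
  finally have "real (\<Sum>x\<in>F. 2 ^ (N - length (c x))) \<le> real (2 ^ N)"
    by (rule of_nat_mono)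
  moreover have "(2 :: real) ^ (N - length (c x)) = 2 ^ N * (1/2) ^ length (c x)" if "x \<in> F" for x
    using N[OF that] by (simp add: power_diff power_one_over)
  then have "real (\<Sum>x\<in>F. 2 ^ (N - length (c x))) = 2 ^ N * (\<Sum>x\<in>F. (1/2) ^ length (c x))"
    by (simp add: sum_distrib_left)
  ultimately show ?thesis by simp
qed

text \<open>
  Gibbs' inequality is used with the constant \<open>1 / ln 2\<close> added on both sides, so that all integrands
  are nonnegative.
\<close>

lemma shannon_entropy_le_expected_length:
  assumes "set_pmf p \<subseteq> A" and c: "prefix_free_code A c"
  shows "shannon_entropy p \<le> expected_length p c"
proof -
  define l where "l x = length (c x)" for x
  define K where "K = ennreal (1 / ln 2)"
  have pointwise: "ennreal (- log 2 (pmf p x)) + K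
      \<le> ennreal (real (l x)) + K * ennreal ((1/2) ^ l x / pmf p x)" if "x \<in> set_pmf p" for x
  proof -
    have pos: "0 < pmf p x" using that by (rule pmf_positive)
    \<comment> \<open>For this ratio of the Kraft weight to the probability,
      \<open>ln u \<le> u - 1\<close> is Gibbs' inequality before averaging.\<close>
    define u where "u = (1/2) ^ l x / pmf p x"
    have "0 < u" using pos by (simp add: u_def)
    then have "ln u \<le> u - 1" by (rule ln_le_minus_one)
    moreover have "ln u = - (real (l x) * ln 2) - ln (pmf p x)"
      using pos by (simp add: u_def ln_div ln_realpow)
    ultimately have "(1 - ln (pmf p x)) / ln 2 \<le> (real (l x) * ln 2 + u) / ln 2"
      by (intro divide_right_mono) auto
    then have "- log 2 (pmf p x) + 1 / ln 2 \<le> real (l x) + 1 / ln 2 * u"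
      by (simp add: log_def diff_divide_distrib add_divide_distrib)
    then have "ennreal (- log 2 (pmf p x) + 1 / ln 2) \<le> ennreal (real (l x) + 1 / ln 2 * u)"
      by (rule ennreal_leI)
    then show ?thesis
      using neg_log_pmf_nonneg[of p x] \<open>0 < u\<close>
      unfolding K_def u_def[symmetric]
      by (simp add: ennreal_mult[symmetric] ennreal_plus[symmetric] del: ennreal_plus)
  qed
  have "(\<integral>\<^sup>+x. ennreal ((1/2) ^ l x / pmf p x) \<partial>measure_pmf p)
      = (\<integral>\<^sup>+x. ennreal ((1/2) ^ l x) \<partial>count_space (set_pmf p))"
    unfolding nn_integral_measure_pmf_set
    by (intro nn_integral_cong) (auto simp: ennreal_mult[symmetric] set_pmf_iff)
  \<comment> \<open>The factor \<open>pmf p x\<close> of the law has cancelled the denominator; a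
    Kraft sum over the support remains.\<close>
  also have "\<dots> \<le> 1"
    using kraft_inequality[OF c] assms(1) by (intro nn_integral_count_space_le) (auto simp: l_def)
  finally have kraft: "(\<integral>\<^sup>+x. ennreal ((1/2) ^ l x / pmf p x) \<partial>measure_pmf p) \<le> 1" .
  have "(\<integral>\<^sup>+x. ennreal (- log 2 (pmf p x)) \<partial>measure_pmf p) + K
      = (\<integral>\<^sup>+x. ennreal (- log 2 (pmf p x)) + K \<partial>measure_pmf p)"
    by (subst nn_integral_add) auto
  also have "\<dots> \<le> (\<integral>\<^sup>+x. ennreal (real (l x)) + K * ennreal ((1/2) ^ l x / pmf p x) \<partial>measure_pmf p)"
    by (intro nn_integral_mono_AE) (auto simp: AE_measure_pmf_iff pointwise)
  also have "\<dots> = (\<integral>\<^sup>+x. ennreal (real (l x)) \<partial>measure_pmf p)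
      + K * (\<integral>\<^sup>+x. ennreal ((1/2) ^ l x / pmf p x) \<partial>measure_pmf p)"
    by (subst nn_integral_add) (auto simp: nn_integral_cmult)
  also have "\<dots> \<le> (\<integral>\<^sup>+x. ennreal (real (l x)) \<partial>measure_pmf p) + K"
    using mult_left_mono[OF kraft, of K] by (intro add_left_mono) auto
  \<comment> \<open>\<open>K\<close> is finite, so it cancels even if the integrals are
    infinite.\<close>
  finally have "(\<integral>\<^sup>+x. ennreal (- log 2 (pmf p x)) \<partial>measure_pmf p)
      \<le> (\<integral>\<^sup>+x. ennreal (real (l x)) \<partial>measure_pmf p)"
    by (simp add: K_def add.commute[of _ "ennreal _"] ennreal_add_left_cancel_le)
  then show ?thesis
    unfolding shannon_entropy_eq_nn_integral expected_length_eq_nn_integral l_def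
    by (simp add: less_eq_ennreal.rep_eq)
qed

section \<open>Codes with prescribed lengths\<close>

text \<open>The parity of the floor at index \<open>i\<close> is the binary digit of weight
  \<open>(1/2) ^ Suc i\<close>, so the most significant digit comes first.\<close>

definition binary_expansion :: "nat \<Rightarrow> real \<Rightarrow> bool list" where
  "binary_expansion k s = map (\<lambda>i. odd \<lfloor>2 ^ Suc i * s\<rfloor>) [0..<k]"

lemma length_binary_expansion [simp]: "length (binary_expansion k s) = k"
  by (simp add: binary_expansion_def)

text \<open>The first \<open>k\<close> digits determine the dyadic interval of length
  \<open>(1/2) ^ k\<close> that contains the number. The induction is on the number of digits and
  starts from the floor 0 common to all of [0, 1).\<close>

lemma prefix_binary_expansion_imp_floor_eq:
  assumes pre: "prefix (binary_expansion k s) (binary_expansion m t)"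
    and s: "0 \<le> s" "s < 1" and t: "0 \<le> t" "t < 1"
  shows "\<lfloor>2 ^ k * s\<rfloor> = \<lfloor>2 ^ k * t\<rfloor>"
proof -
  have km: "k \<le> m" using prefix_length_le[OF pre] by simp
  have bits: "odd \<lfloor>2 ^ Suc i * s\<rfloor> \<longleftrightarrow> odd \<lfloor>2 ^ Suc i * t\<rfloor>" if "i < k" for i
  proof -
    have "binary_expansion k s ! i = binary_expansion m t ! i"
      using pre that by (auto simp: prefix_def nth_append)
    then show ?thesis
      using that km by (simp add: binary_expansion_def)
  qed
  have double: "\<lfloor>2 * a\<rfloor> = 2 * \<lfloor>a\<rfloor> + of_bool (odd \<lfloor>2 * a\<rfloor>)" for a :: real
  proof -
    have "\<lfloor>2 * a\<rfloor> = 2 * \<lfloor>a\<rfloor> \<or> \<lfloor>2 * a\<rfloor> = 2 * \<lfloor>a\<rfloor> + 1" by linarith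
    then show ?thesis by auto
  qed
  have "j \<le> k \<Longrightarrow> \<lfloor>2 ^ j * s\<rfloor> = \<lfloor>2 ^ j * t\<rfloor>" for j
  proof (induction j)
    case 0
    have "\<lfloor>s\<rfloor> = 0" "\<lfloor>t\<rfloor> = 0" using s t by (auto simp: floor_eq_iff)
    then show ?case by simp
  next
    case (Suc j)
    then show ?case
      using double[of "2 ^ j * s"] double[of "2 ^ j * t"] bits[of j] by (simp add: mult.assoc)
  qed
  then show ?thesis by simp
qed

text \<open>
  The Shannon--Fano construction: with the letters sorted by codeword length (ties broken by an
  enumeration), the codeword of \<open>x\<close> is the binary expansion of the total weight \<open>s x\<close> of the letters
  before \<open>x\<close>, cut off after \<open>l x\<close> digits.
\<close>

lemma kraft_converse:
  assumes "countable A"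
    and kraft: "\<And>F. finite F \<Longrightarrow> F \<subseteq> A \<Longrightarrow> (\<Sum>x\<in>F. (1/2 :: real) ^ l x) \<le> 1"
  shows "\<exists>c. prefix_free_code A c \<and> (\<forall>x. length (c x) = l x)"
proof -
  define w where "w x = (1/2 :: real) ^ l x" for x
  define e where "e = to_nat_on A"
  define before where "before y x \<longleftrightarrow> l y < l x \<or> l y = l x \<and> e y < e x" for x y
  define B where "B x = {y \<in> A. before y x}" for x
  define s where "s x = infsum w (B x)" for x
  have w: "w summable_on A"
    using kraft by (intro nonneg_bdd_above_summable_on bdd_aboveI[of _ 1]) (auto simp: w_def)
  then have wB: "w summable_on C" if "C \<subseteq> A" for C
    using that summable_on_subset_banach by blast
  have insert_B: "infsum w (insert x (B x)) = w x + s x" if "x \<in> A" for x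
    unfolding s_def by (subst infsum_insert) (auto intro!: wB simp: B_def before_def)
  \<comment> \<open>\<open>before\<close> is transitive, so \<open>B y\<close> contains both
    \<open>x\<close> and \<open>B x\<close>.\<close>
  have step: "s x + w x \<le> s y" if "x \<in> A" "before x y" for x y
  proof -
    have "infsum w (insert x (B x)) \<le> infsum w (B y)"
      using that by (intro infsum_mono2 wB) (auto simp: B_def w_def before_def)
    then show ?thesis using insert_B[OF that(1)] by (simp add: s_def)
  qed
  have s: "0 \<le> s x" "s x < 1" if "x \<in> A" for x
  proof -
    show "0 \<le> s x" unfolding s_def by (intro infsum_nonneg) (auto simp: w_def)
    have "infsum w (insert x (B x)) \<le> 1"
      using that by (intro infsum_le_finite_sums wB) (auto simp: w_def B_def intro!: kraft)
    moreover have "0 < w x" by (simp add: w_def)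
    ultimately show "s x < 1" using insert_B[OF that] by simp
  qed
  define c where "c x = binary_expansion (l x) (s x)" for x
  \<comment> \<open>The gap \<open>w x\<close> becomes 1 after scaling by
    \<open>2 ^ l x\<close>.\<close>
  have floor_ne: "\<lfloor>2 ^ l x * s x\<rfloor> \<noteq> \<lfloor>2 ^ l x * s y\<rfloor>" if "x \<in> A" "before x y" for x y
  proof -
    have "2 ^ l x * (s x + w x) \<le> 2 ^ l x * s y"
      using step[OF that] by (intro mult_left_mono) auto
    then have "2 ^ l x * s x + 1 \<le> 2 ^ l x * s y"
      by (simp add: w_def power_one_over distrib_left)
    then show ?thesis by linarith
  qed
  have "x = y" if "x \<in> A" "y \<in> A" and pre: "prefix (c x) (c y)" for x y
  proof (rule ccontr)
    assume "x \<noteq> y"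
    then have "e x \<noteq> e y"
      unfolding e_def using that assms(1) by (simp add: to_nat_on_inj)
    \<comment> \<open>A prefix is not longer, so \<open>y\<close> can come before \<open>x\<close>
      only in a tie of lengths, where \<open>floor_ne\<close> for \<open>y\<close> uses the same
      scale.\<close>
    moreover have "l x \<le> l y"
      using prefix_length_le[OF pre] by (simp add: c_def)
    ultimately consider "before x y" | "before y x" "l x = l y"
      unfolding before_def by linarith
    moreover have "\<lfloor>2 ^ l x * s x\<rfloor> = \<lfloor>2 ^ l x * s y\<rfloor>"
      using prefix_binary_expansion_imp_floor_eq[OF pre[unfolded c_def]] s that by simp
    ultimately show False
      using floor_ne[of x y] floor_ne[of y x] that by cases auto
  qed
  then have "prefix_free_code A c"
    unfolding prefix_free_code_def by blast
  then show ?thesis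
    by (intro exI[of _ c]) (simp add: c_def)
qed

section \<open>The upper bound on the minimal expected length\<close>

text \<open>Reindexing by \<open>e\<close> gives part of a geometric series. These weights will
  serve the letters of probability 0.\<close>

lemma sum_geometric_inj_le:
  assumes "finite F" "inj_on e F"
  shows "(\<Sum>x\<in>F. (1/2 :: real) ^ Suc (e x)) \<le> 1"
proof -
  have sums: "(\<lambda>i. (1/2 :: real) ^ Suc i) sums 1"
    by (rule power_half_series)
  have "(\<Sum>x\<in>F. (1/2 :: real) ^ Suc (e x)) = (\<Sum>i\<in>e ` F. (1/2) ^ Suc i)"
    by (simp add: sum.reindex[OF assms(2)])
  also have "\<dots> \<le> (\<Sum>i. (1/2) ^ Suc i)"
    using assms sums_summable[OF sums] by (intro sum_le_suminf) auto
  also have "\<dots> = 1"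
    using sums by (rule sums_unique[symmetric])
  finally show ?thesis .
qed

text \<open>
  Rounding \<open>- log 2 p\<close> strictly up makes the Kraft sum over the support strictly less than \<open>1\<close>;
  the slack \<open>\<delta>\<close> accommodates the letters of \<open>A\<close> that have probability \<open>0\<close>.
\<close>

lemma min_expected_length_le:
  assumes "countable A" and sub: "set_pmf p \<subseteq> A"
  shows "min_expected_length A p \<le> shannon_entropy p + 1"
proof -
  \<comment> \<open>\<open>Suc\<close> of the floor exceeds \<open>- log 2 (pmf p x)\<close>
    strictly, also when that is an integer, and by at most 1.\<close>
  define k where "k x = Suc (nat \<lfloor>- log 2 (pmf p x)\<rfloor>)" for x
  have k_less: "(1/2) ^ k x < pmf p x" if "x \<in> set_pmf p" for x
  proof -
    have pos: "0 < pmf p x" using that by (rule pmf_positive)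
    have "- real (k x) < log 2 (pmf p x)"
      using neg_log_pmf_nonneg[of p x] unfolding k_def by linarith
    then have "2 powr (- real (k x)) < pmf p x"
      using pos by (simp add: less_log_iff)
    then show ?thesis
      by (simp add: powr_minus powr_realpow power_one_over inverse_eq_divide)
  qed
  obtain x0 where x0: "x0 \<in> set_pmf p"
    using set_pmf_not_empty[of p] by blast
  define \<delta> where "\<delta> = pmf p x0 - (1/2) ^ k x0"
  have \<delta>: "0 < \<delta>" using k_less[OF x0] by (simp add: \<delta>_def)
  \<comment> \<open>The extra length \<open>m\<close> keeps the total weight of the letters of
    probability 0 below \<open>\<delta>\<close>.\<close>
  obtain m where m: "(1/2) ^ m < \<delta>"
    using real_arch_pow_inv[OF \<delta>, of "1/2"] by auto
  define e where "e = to_nat_on A"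
  have inj: "inj_on e A" unfolding e_def using assms(1) by (rule inj_on_to_nat_on)
  define l where "l x = (if x \<in> set_pmf p then k x else m + Suc (e x))" for x
  \<comment> \<open>The slack gained at \<open>x0\<close> on the left pays for the geometric weights
    on the right: after summation both sides carry a \<open>\<delta>\<close>, which cancels.\<close>
  have pointwise: "(1/2) ^ l x + \<delta> * of_bool (x = x0) \<le> pmf p x + \<delta> * (1/2) ^ Suc (e x)" for x
  proof (cases "x \<in> set_pmf p")
    case True
    have "(1/2) ^ k x + \<delta> * of_bool (x = x0) \<le> pmf p x"
      using k_less[OF True] by (auto simp: \<delta>_def)
    moreover have "0 \<le> \<delta> * (1/2) ^ Suc (e x)" using \<delta> by simp
    ultimately show ?thesis using True by (simp add: l_def)
  next
    case False
    then have "x \<noteq> x0" using x0 by blast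
    moreover have "(1/2) ^ m * (1/2) ^ Suc (e x) \<le> \<delta> * (1/2) ^ Suc (e x)"
      using m by (intro mult_right_mono) auto
    ultimately show ?thesis
      using False by (simp add: l_def power_add add_increasing)
  qed
  have "(\<Sum>x\<in>F. (1/2 :: real) ^ l x) \<le> 1" if F: "finite F" "F \<subseteq> A" for F
  proof -
    \<comment> \<open>The slack enters only sums that contain \<open>x0\<close>.\<close>
    define G where "G = insert x0 F"
    have G: "finite G" "G \<subseteq> A" using F x0 sub by (auto simp: G_def)
    have "(\<Sum>x\<in>G. (1/2) ^ l x) + \<delta> = (\<Sum>x\<in>G. (1/2) ^ l x + \<delta> * of_bool (x = x0))"
      using G(1) by (simp add: sum.distrib sum_distrib_left[symmetric] G_def of_bool_def sum.delta)
    also have "\<dots> \<le> (\<Sum>x\<in>G. pmf p x + \<delta> * (1/2) ^ Suc (e x))"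
      by (intro sum_mono pointwise)
    also have "\<dots> = measure p G + \<delta> * (\<Sum>x\<in>G. (1/2) ^ Suc (e x))"
      using G(1) by (simp add: sum.distrib sum_distrib_left measure_measure_pmf_finite)
    also have "\<dots> \<le> 1 + \<delta> * 1"
      using G \<delta> inj by (intro add_mono mult_left_mono sum_geometric_inj_le)
        (auto intro: inj_on_subset)
    finally have "(\<Sum>x\<in>G. (1/2 :: real) ^ l x) \<le> 1" by simp
    moreover have "(\<Sum>x\<in>F. (1/2 :: real) ^ l x) \<le> (\<Sum>x\<in>G. (1/2) ^ l x)"
      using G by (intro sum_mono2) (auto simp: G_def)
    ultimately show ?thesis by linarith
  qed
  from kraft_converse[OF assms(1) this] obtain c
    where c: "prefix_free_code A c" and len: "\<And>x. length (c x) = l x" by auto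
  have "(\<integral>\<^sup>+x. ennreal (real (length (c x))) \<partial>measure_pmf p)
      \<le> (\<integral>\<^sup>+x. ennreal (- log 2 (pmf p x)) + 1 \<partial>measure_pmf p)"
  proof (intro nn_integral_mono_AE, unfold AE_measure_pmf_iff, intro ballI)
    fix x assume "x \<in> set_pmf p"
    then have "real (length (c x)) \<le> - log 2 (pmf p x) + 1"
      using neg_log_pmf_nonneg[of p x] by (simp add: len l_def k_def)
    then have "ennreal (real (length (c x))) \<le> ennreal (- log 2 (pmf p x) + 1)"
      by (rule ennreal_leI)
    then show "ennreal (real (length (c x))) \<le> ennreal (- log 2 (pmf p x)) + 1"
      using neg_log_pmf_nonneg[of p x] by (subst (asm) ennreal_plus) auto
  qed
  also have "\<dots> = (\<integral>\<^sup>+x. ennreal (- log 2 (pmf p x)) \<partial>measure_pmf p) + 1"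
    by (subst nn_integral_add) auto
  finally have "expected_length p c \<le> shannon_entropy p + 1"
    unfolding expected_length_eq_nn_integral shannon_entropy_eq_nn_integral
    by (simp add: less_eq_ennreal.rep_eq plus_ennreal.rep_eq one_ennreal.rep_eq)
  moreover have "min_expected_length A p \<le> expected_length p c"
    unfolding min_expected_length_def using c by (intro INF_lower) auto
  ultimately show ?thesis by (rule order_trans[rotated])
qed

lemma shannon_entropy_le_min_expected_length:
  assumes "set_pmf p \<subseteq> A"
  shows "shannon_entropy p \<le> min_expected_length A p"
  unfolding min_expected_length_def
  using shannon_entropy_le_expected_length[OF assms] by (auto intro: INF_greatest)

theorem theorem4p2:
  fixes A :: "'a set"
    and pX qX :: "'a pmf"
    and n :: nat
    and \<nu> :: "'z pmf"
    and Zn :: "'z list pmf"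
    and g :: "'z list \<Rightarrow> 'a"
    and d :: "'a pmf \<Rightarrow> 'a pmf \<Rightarrow> ereal"
  assumes "countable A" and "set_pmf pX \<subseteq> A"
    and "n \<ge> 1"
    and "Zn = replicate_pmf n \<nu>"
    and "shannon_entropy Zn = ereal (26.55 * real n)"
    and "qX = map_pmf g Zn" and "set_pmf qX \<subseteq> A"
    and "divergence_on A d"
    and "d pX qX = 0"
  shows "ereal (real n) \<ge> shannon_entropy pX / ereal 26.55 \<and>
         shannon_entropy pX / ereal 26.55 \<ge> (min_expected_length A pX - 1) / ereal 26.55 \<and>
         (bij_betw g (set_pmf Zn) (set_pmf qX) \<longrightarrow>
            ereal (real n) \<le> (shannon_entropy pX + 2) / ereal 26.55 \<and>
            (shannon_entropy pX + 2) / ereal 26.55 \<le> (min_expected_length A pX + 2) / ereal 26.55)"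
proof -
  have eq: "qX = pX"
    using assms unfolding divergence_on_def by metis
  have upper: "shannon_entropy pX \<le> ereal (26.55 * real n)"
    using shannon_entropy_map_le[of g Zn] assms(5,6) eq by simp
  moreover have "0 \<le> shannon_entropy pX"
    unfolding shannon_entropy_eq_nn_integral by simp
  \<comment> \<open>The entropy lies between 0 and \<open>26.55 * real n\<close>, hence is finite;
    by the coding bounds so is the minimal expected length, and real arithmetic remains.\<close>
  ultimately obtain h where h: "shannon_entropy pX = ereal h"
    by (cases "shannon_entropy pX") auto
  have L: "min_expected_length A pX \<le> ereal (h + 1)" "ereal h \<le> min_expected_length A pX"
    using min_expected_length_le[OF assms(1,2)] shannon_entropy_le_min_expected_length[OF assms(2)]
    by (simp_all add: h one_ereal_def)
  then obtain L where L_eq: "min_expected_length A pX = ereal L"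
    by (cases "min_expected_length A pX") auto
  \<comment> \<open>Injectivity on the support preserves the entropy, so \<open>n\<close> equals
    \<open>h / 26.55\<close>, which lies below the claimed bound.\<close>
  have bij: "h = 26.55 * real n" if "bij_betw g (set_pmf Zn) (set_pmf qX)"
    using shannon_entropy_map_inj[OF bij_betw_imp_inj_on[OF that]] assms(5,6) eq h by simp
  show ?thesis
    using upper L bij unfolding h L_eq
    by (auto simp: one_ereal_def field_simps)
qed

end
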